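(* Let $d,n\ge 1$ be integers. Fix a mesh strategy, i.e. constants $C_q,C_p>0$, and a neighbor strategy, i.e. shift integer vectors $\bm{\delta q}^{(k)},\bm{\delta p}^{(k)}\in\mathbb{Z}^d$ for $k=1,\dots,n$. Then for all $\varepsilon_1,\varepsilon_2>0$, $$\sup_{(\bm{Q},\bm{P})\in[0,\Delta q_1]^d\times[0,\Delta p_1]^d}E_{\mathrm{LSA}}(\varepsilon_1,\bm{Q},\bm{P},\Delta q_1,\Delta p_1)=\sup_{(\bm{Q},\bm{P})\in[0,\Delta q_2]^d\times[0,\Delta p_2]^d}E_{\mathrm{LSA}}(\varepsilon_2,\bm{Q},\bm{P},\Delta q_2,\Delta p_2),$$ where $\Delta q_i=C_q\sqrt{\varepsilon_i}$ and $\Delta p_i=C_p\sqrt{\varepsilon_i}$ for $i=1,2$.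
   Context: The function $\operatorname{floor}(\cdot)$ is applied componentwise to vectors in $\mathbb{R}^d$. Gaussian wave-packet: for $\varepsilon>0$ and $\bm{Q},\bm{P}\in\mathbb{R}^d$, define $G(\cdot;\bm{Q},\bm{P},\varepsilon):\mathbb{R}^d\to\mathbb{C}$ by $$G(\bm{x};\bm{Q},\bm{P},\varepsilon)=\exp\left(\frac{\mathrm{i}}{\varepsilon}\bm{P}\cdot(\bm{x}-\bm{Q})-\frac{1}{2\varepsilon}|\bm{x}-\bm{Q}|^2\right).$$ Neighbor map: given mesh steps $\Delta q,\Delta p>0$ and shift integer vectors $\bm{\delta q}^{(k)},\bm{\delta p}^{(k)}\in\mathbb{Z}^d$ ($k=1,\dots,n$), define $\bm{\mathcal{N}}(\bm{Q},\bm{P};k)=(\bm{Q}^{(k)},\bm{P}^{(k)})$ with $$\bm{Q}^{(k)}=\operatorname{floor}\left(\frac{\bm{Q}}{\Delta q}\right)\Delta q+\bm{\delta q}^{(k)}\Delta q,\qquad \bm{P}^{(k)}=\operatorname{floor}\left(\frac{\bm{P}}{\Delta p}\right)\Delta p+\bm{\delta p}^{(k)}\Delta p.$$ Relative least squares approximation (LSA) error: $$E_{\mathrm{LSA}}(\varepsilon,\bm{Q},\bm{P},\Delta q,\Delta p)=\frac{\left\|G(\cdot;\bm{Q},\bm{P},\varepsilon)-\sum_{k=1}^n c^{(k)}G(\cdot;\bm{\mathcal{N}}(\bm{Q},\bm{P};k),\varepsilon)\right\|_{L^2(\mathbb{R}^d)}}{\left\|G(\cdot;\bm{Q},\bm{P},\varepsilon)\right\|_{L^2(\mathbb{R}^d)}},$$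 where $(c^{(1)},\dots,c^{(n)})\in\mathbb{C}^n$ are least squares coefficients, i.e. a minimizer over $\mathbb{C}^n$ of the $L^2(\mathbb{R}^d)$ norm in the numerator (the value of $E_{\mathrm{LSA}}$ does not depend on which minimizer is chosen). The neighbor map is taken with the same $\Delta q,\Delta p$ that appear as arguments of $E_{\mathrm{LSA}}$ and with the fixed shift integers. *)

theory Defs
  imports "HOL-Analysis.Analysis"
begin

definition gaussian_wp ::
  "real ^ 'd \<Rightarrow> real ^ 'd \<Rightarrow> real \<Rightarrow> real ^ 'd \<Rightarrow> complex" where
  "gaussian_wp Q P \<epsilon> x =
     exp (\<i> / of_real \<epsilon> * of_real (P \<bullet> (x - Q)) - of_real (1 / (2 * \<epsilon>) * (norm (x - Q))\<^sup>2))"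

(* Meaningful for square-integrable f only; it is applied only to finite linear
   combinations of Gaussian wave-packets, which are. *)
definition L2norm :: "(real ^ 'd \<Rightarrow> complex) \<Rightarrow> real" where
  "L2norm f = sqrt (\<integral>x. (cmod (f x))\<^sup>2 \<partial>lborel)"

definition vec_floor :: "real ^ 'd \<Rightarrow> int ^ 'd" where
  "vec_floor v = (\<chi> i. \<lfloor>v $ i\<rfloor>)"

definition vec_of_int :: "int ^ 'd \<Rightarrow> real ^ 'd" where
  "vec_of_int v = (\<chi> i. of_int (v $ i))"

(* The index type 'n has n elements and plays the role of {1..n}. *)
definition neighbor ::
  "('n \<Rightarrow> int ^ 'd) \<Rightarrow> ('n \<Rightarrow> int ^ 'd) \<Rightarrow> real \<Rightarrow> real \<Rightarrow>
    real ^ 'd \<Rightarrow> real ^ 'd \<Rightarrow> 'n \<Rightarrow> (real ^ 'd) \<times> (real ^ 'd)" where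
  "neighbor \<delta>q \<delta>p \<Delta>q \<Delta>p Q P k =
     (\<Delta>q *\<^sub>R vec_of_int (vec_floor (Q /\<^sub>R \<Delta>q)) + \<Delta>q *\<^sub>R vec_of_int (\<delta>q k),
      \<Delta>p *\<^sub>R vec_of_int (vec_floor (P /\<^sub>R \<Delta>p)) + \<Delta>p *\<^sub>R vec_of_int (\<delta>p k))"

definition lsa_residual ::
  "('n::finite \<Rightarrow> int ^ 'd) \<Rightarrow> ('n \<Rightarrow> int ^ 'd) \<Rightarrow> real \<Rightarrow> real ^ 'd \<Rightarrow> real ^ 'd \<Rightarrow>
    real \<Rightarrow> real \<Rightarrow> complex ^ 'n \<Rightarrow> real" where
  "lsa_residual \<delta>q \<delta>p \<epsilon> Q P \<Delta>q \<Delta>p c =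
     L2norm (\<lambda>x. gaussian_wp Q P \<epsilon> x -
       (\<Sum>k\<in>UNIV. c $ k *
          (case neighbor \<delta>q \<delta>p \<Delta>q \<Delta>p Q P k of (Qk, Pk) \<Rightarrow> gaussian_wp Qk Pk \<epsilon> x)))"

(* Some minimizer over all of C^n. Minimizers exist because the neighboring wave-packets
   span a finite-dimensional subspace of L^2; they need not be unique. *)
definition lsa_coeffs ::
  "('n::finite \<Rightarrow> int ^ 'd) \<Rightarrow> ('n \<Rightarrow> int ^ 'd) \<Rightarrow> real \<Rightarrow> real ^ 'd \<Rightarrow> real ^ 'd \<Rightarrow>
    real \<Rightarrow> real \<Rightarrow> complex ^ 'n" where
  "lsa_coeffs \<delta>q \<delta>p \<epsilon> Q P \<Delta>q \<Delta>p = arg_min (lsa_residual \<delta>q \<delta>p \<epsilon> Q P \<Delta>q \<Delta>p) (\<lambda>_. True)"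

definition E_LSA ::
  "('n::finite \<Rightarrow> int ^ 'd) \<Rightarrow> ('n \<Rightarrow> int ^ 'd) \<Rightarrow> real \<Rightarrow> real ^ 'd \<Rightarrow> real ^ 'd \<Rightarrow>
    real \<Rightarrow> real \<Rightarrow> real" where
  "E_LSA \<delta>q \<delta>p \<epsilon> Q P \<Delta>q \<Delta>p =
     lsa_residual \<delta>q \<delta>p \<epsilon> Q P \<Delta>q \<Delta>p (lsa_coeffs \<delta>q \<delta>p \<epsilon> Q P \<Delta>q \<Delta>p)
       / L2norm (gaussian_wp Q P \<epsilon>)"

definition cube :: "real \<Rightarrow> (real ^ 'd) set" where
  "cube a = {v. \<forall>i. v $ i \<in> {0..a}}"

end

theory Submission
  imports Defs
begin

text \<open>Dilating space by \<open>s\<close> maps the wave-packet with parameters \<open>(Q, P, \<epsilon>)\<close> to the one with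
  parameters \<open>(s Q, s P, s\<^sup>2 \<epsilon>)\<close>, without any extra phase factor, and commutes with the neighbor map when
  the mesh steps are dilated too. Hence for every coefficient vector the residual is merely multiplied
  by the power of \<open>s\<close> by which the norm of the wave-packet itself is multiplied: the minimizers
  are the same and the relative error is unchanged. The theorem is the case \<open>s = sqrt (\<epsilon>2 / \<epsilon>1)\<close>.\<close>

text \<open>Phase and squared distance are both quadratic in the dilated vectors, so each gains
  \<open>s\<^sup>2\<close>, which cancels against the one in the new
  \<open>\<epsilon>\<close>.\<close>

lemma gaussian_wp_scale:
  assumes "s \<noteq> 0"
  shows "gaussian_wp (s *\<^sub>R Q) (s *\<^sub>R P) (s\<^sup>2 * \<epsilon>) (s *\<^sub>R x) = gaussian_wp Q P \<epsilon> x"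
proof -
  have diff: "s *\<^sub>R x - s *\<^sub>R Q = s *\<^sub>R (x - Q)"
    by (simp add: scaleR_diff_right)
  have phase: "\<i> / of_real (s\<^sup>2 * \<epsilon>) * of_real (s *\<^sub>R P \<bullet> s *\<^sub>R (x - Q))
      = \<i> / of_real \<epsilon> * of_real (P \<bullet> (x - Q))"
    using assms by (simp add: power2_eq_square)
  have modulus: "1 / (2 * (s\<^sup>2 * \<epsilon>)) * (norm (s *\<^sub>R (x - Q)))\<^sup>2 = 1 / (2 * \<epsilon>) * (norm (x - Q))\<^sup>2"
    using assms by (simp add: power_mult_distrib)
  show ?thesis
    unfolding gaussian_wp_def diff phase modulus ..
qed

lemma continuous_on_gaussian_wp: "continuous_on A (gaussian_wp Q P \<epsilon>)"
  unfolding gaussian_wp_def divide_inverse by (intro continuous_intros)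

lemma borel_measurable_gaussian_wp [measurable]: "gaussian_wp Q P \<epsilon> \<in> borel_measurable borel"
  by (rule borel_measurable_continuous_onI) (rule continuous_on_gaussian_wp)

text \<open>Change of variables: the Jacobian \<open>s ^ CARD('d)\<close> of the dilation comes out
  of the integral, and its root out of the norm.\<close>

lemma L2norm_scale:
  fixes f :: "real ^ 'd \<Rightarrow> complex"
  assumes [measurable]: "f \<in> borel_measurable borel" and "s > 0"
  shows "L2norm f = sqrt (s ^ CARD('d)) * L2norm (\<lambda>x. f (s *\<^sub>R x))"
proof -
  have "lborel = density (distr lborel borel (\<lambda>x :: real ^ 'd. s *\<^sub>R x)) (\<lambda>_. ennreal (s ^ CARD('d)))"
    using lborel_affine[of s "0 :: real ^ 'd"] \<open>s > 0\<close> by simp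
  then have "(\<integral>x. (cmod (f x))\<^sup>2 \<partial>lborel) = (\<integral>x. (cmod (f x))\<^sup>2
      \<partial>density (distr lborel borel (\<lambda>x :: real ^ 'd. s *\<^sub>R x)) (\<lambda>_. ennreal (s ^ CARD('d))))"
    by simp
  also have "\<dots> = s ^ CARD('d) * (\<integral>x. (cmod (f (s *\<^sub>R x)))\<^sup>2 \<partial>lborel)"
    using \<open>s > 0\<close> by (simp add: integral_density integral_distr)
  finally show ?thesis
    by (simp add: L2norm_def real_sqrt_mult)
qed

text \<open>The arguments of the floor are ratios of position or momentum to mesh step, hence
  unchanged; only the outer mesh steps contribute \<open>s\<close>.\<close>

lemma neighbor_scale:
  fixes \<delta>q \<delta>p :: "'n \<Rightarrow> int ^ 'd"
  assumes "s \<noteq> 0"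
  shows "neighbor \<delta>q \<delta>p (s * \<Delta>q) (s * \<Delta>p) (s *\<^sub>R Q) (s *\<^sub>R P) k
    = map_prod (scaleR s) (scaleR s) (neighbor \<delta>q \<delta>p \<Delta>q \<Delta>p Q P k)"
proof -
  have "(s *\<^sub>R v) /\<^sub>R (s * a) = v /\<^sub>R a" for v :: "real ^ 'd" and a
    using assms by simp
  then show ?thesis
    unfolding neighbor_def by (simp only: map_prod_simp) (simp add: scaleR_add_right)
qed

lemma lsa_residual_scale:
  fixes \<delta>q \<delta>p :: "'n::finite \<Rightarrow> int ^ 'd::finite"
  assumes "s > 0"
  shows "lsa_residual \<delta>q \<delta>p (s\<^sup>2 * \<epsilon>) (s *\<^sub>R Q) (s *\<^sub>R P) (s * \<Delta>q) (s * \<Delta>p) c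
    = sqrt (s ^ CARD('d)) * lsa_residual \<delta>q \<delta>p \<epsilon> Q P \<Delta>q \<Delta>p c"
proof -
  have "s \<noteq> 0"
    using assms by simp
  show ?thesis
    unfolding lsa_residual_def neighbor_scale[OF \<open>s \<noteq> 0\<close>] case_prod_unfold fst_map_prod snd_map_prod
    \<comment> \<open>Pulling the left-hand residual back along the dilation turns each of its
      packets into the original one, with the same \<open>c\<close>.\<close>
    by (subst L2norm_scale[OF _ assms]) (simp_all add: gaussian_wp_scale[OF \<open>s \<noteq> 0\<close>])
qed

text \<open>Both functions have the same minimizers, so the choice inside \<open>arg_min\<close>
  picks the same element even when there are several.\<close>

lemma arg_min_cmult:
  fixes f :: "'a \<Rightarrow> real"
  assumes "a > 0"
  shows "arg_min (\<lambda>x. a * f x) P = arg_min f P"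
  using assms by (simp add: arg_min_def is_arg_min_def)

lemma E_LSA_scale:
  fixes \<delta>q \<delta>p :: "'n::finite \<Rightarrow> int ^ 'd::finite"
  assumes "s > 0"
  shows "E_LSA \<delta>q \<delta>p (s\<^sup>2 * \<epsilon>) (s *\<^sub>R Q) (s *\<^sub>R P) (s * \<Delta>q) (s * \<Delta>p)
    = E_LSA \<delta>q \<delta>p \<epsilon> Q P \<Delta>q \<Delta>p"
proof -
  have a: "sqrt (s ^ CARD('d)) > 0"
    using assms by simp
  have coeffs: "lsa_coeffs \<delta>q \<delta>p (s\<^sup>2 * \<epsilon>) (s *\<^sub>R Q) (s *\<^sub>R P) (s * \<Delta>q) (s * \<Delta>p)
      = lsa_coeffs \<delta>q \<delta>p \<epsilon> Q P \<Delta>q \<Delta>p"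
    unfolding lsa_coeffs_def lsa_residual_scale[OF assms, abs_def] by (rule arg_min_cmult[OF a])
  have norm: "L2norm (gaussian_wp (s *\<^sub>R Q) (s *\<^sub>R P) (s\<^sup>2 * \<epsilon>))
      = sqrt (s ^ CARD('d)) * L2norm (gaussian_wp Q P \<epsilon>)"
    using assms by (subst L2norm_scale[OF _ assms]) (simp_all add: gaussian_wp_scale)
  show ?thesis
    unfolding E_LSA_def coeffs norm lsa_residual_scale[OF assms] using assms by simp
qed

lemma cube_scale:
  assumes "s > 0"
  shows "cube (s * a) = scaleR s ` cube a"
proof (intro subset_antisym subsetI)
  fix v :: "real ^ 'd"
  assume "v \<in> cube (s * a)"
  then have "v /\<^sub>R s \<in> cube a"
    using assms by (simp add: cube_def field_simps)
  moreover have "v = s *\<^sub>R (v /\<^sub>R s)"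
    using assms by simp
  ultimately show "v \<in> scaleR s ` cube a"
    by (rule rev_image_eqI)
next
  fix v :: "real ^ 'd"
  assume "v \<in> scaleR s ` cube a"
  then show "v \<in> cube (s * a)"
    using assms by (auto simp: cube_def)
qed

theorem theorem3:
  fixes \<delta>q \<delta>p :: "'n::finite \<Rightarrow> int ^ 'd::finite"
    and Cq Cp \<epsilon>1 \<epsilon>2 \<Delta>q1 \<Delta>p1 \<Delta>q2 \<Delta>p2 :: real
  assumes "Cq > 0" and "Cp > 0"
    and "\<epsilon>1 > 0" and "\<epsilon>2 > 0"
    and "\<Delta>q1 = Cq * sqrt \<epsilon>1" and "\<Delta>p1 = Cp * sqrt \<epsilon>1"
    and "\<Delta>q2 = Cq * sqrt \<epsilon>2" and "\<Delta>p2 = Cp * sqrt \<epsilon>2"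
  shows "(SUP (Q, P) \<in> cube \<Delta>q1 \<times> cube \<Delta>p1. ereal (E_LSA \<delta>q \<delta>p \<epsilon>1 Q P \<Delta>q1 \<Delta>p1))
       = (SUP (Q, P) \<in> cube \<Delta>q2 \<times> cube \<Delta>p2. ereal (E_LSA \<delta>q \<delta>p \<epsilon>2 Q P \<Delta>q2 \<Delta>p2))"
proof -
  define s where "s = sqrt (\<epsilon>2 / \<epsilon>1)"
  have "s > 0" and \<epsilon>2: "\<epsilon>2 = s\<^sup>2 * \<epsilon>1" and "sqrt \<epsilon>2 = s * sqrt \<epsilon>1"
    using assms(3,4) by (simp_all add: s_def real_sqrt_divide power_divide)
  \<comment> \<open>The square-root mesh strategy enters here: the mesh steps grow by the very
    factor \<open>s\<close> that dilates space.\<close>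
  then have \<Delta>2: "\<Delta>q2 = s * \<Delta>q1" "\<Delta>p2 = s * \<Delta>p1"
    using assms(5-8) by simp_all
  \<comment> \<open>Reindexing along this image makes the two suprema agree term by term.\<close>
  have "cube \<Delta>q2 \<times> cube \<Delta>p2
      = map_prod (scaleR s) (scaleR s) ` (cube \<Delta>q1 \<times> cube \<Delta>p1 :: ((real ^ 'd) \<times> (real ^ 'd)) set)"
    unfolding \<Delta>2 cube_scale[OF \<open>s > 0\<close>] by (rule map_prod_surj_on[symmetric]) simp_all
  then show ?thesis
    by (simp add: image_image case_prod_unfold \<epsilon>2 \<Delta>2 E_LSA_scale[OF \<open>s > 0\<close>])
qed

end
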